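(* Let $\mathbb{X}\subseteq\mathbb{R}^n$, $b\in\mathbb{R}$, $\epsilon\in[0,1)$, let $\ell$ be a positive integer, $\Lambda=\{0,1,\dots,\ell\}$, $\lambda_i=i/\ell$. Let $\boldsymbol{\Sigma}\in\mathbb{R}^{n\times n}$ be a symmetric positive definite (covariance) matrix and $\boldsymbol{B}=\boldsymbol{\Sigma}^{-1/2}$, with $j$th column $\boldsymbol{B}_j$. Let $\pi$ be the joint possibility distribution described in the context, built with the deviation function $\delta(\boldsymbol{a})=\|\boldsymbol{B}(\boldsymbol{a}-\hat{\boldsymbol{a}})\|_2$, so that $$\mathcal{C}(\lambda_i)=\{\boldsymbol{a}\in\mathbb{R}^n:\ \underline{\boldsymbol{a}}(\lambda_i)\le\boldsymbol{a}\le\overline{\boldsymbol{a}}(\lambda_i),\ \|\boldsymbol{B}(\boldsymbol{a}-\hat{\boldsymbol{a}})\|_2\le\overline{\delta}(\lambda_i)\},\quad i\in\Lambda.$$ Then for every $\boldsymbol{x}\in\mathbb{X}$ the constraint $$\sup_{\mathrm{P}\in\mathcal{P}^{\ell}_\pi}\mathrm{CVaR}^{\epsilon}_{\mathrm{P}}[\tilde{\boldsymbol{a}}^T\boldsymbol{x}]\le b$$ is equivalent to the following system of second-order cone constraints, i.e. it holds if and only if there exist $w,t\in\mathbb{R}$, $v_i,\gamma_i\in\mathbb{R}$ and $\boldsymbol{\alpha}_i,\boldsymbol{\beta}_i,\boldsymbol{u}_i\in\mathbb{R}^n$ ($i\in\Lambda$) such that $$\begin{aligned} & w+\sum_{i\in\Lambda}(\lambda_i-1)v_i\le(b-t)(1-\epsilon),\\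 & w-\sum_{j\le i}v_j\ge 0 && \forall i\in\Lambda,\\ & w-\sum_{j\le i}v_j+t\ge (\overline{\boldsymbol{a}}(\lambda_i)-\hat{\boldsymbol{a}})^T\boldsymbol{\alpha}_i+(\hat{\boldsymbol{a}}-\underline{\boldsymbol{a}}(\lambda_i))^T\boldsymbol{\beta}_i+\overline{\delta}(\lambda_i)\gamma_i+\hat{\boldsymbol{a}}^T\boldsymbol{x} && \forall i\in\Lambda,\\ & \alpha_{ij}-\beta_{ij}+\boldsymbol{B}_j^T\boldsymbol{u}_i=x_j && \forall j\in[n],\ \forall i\in\Lambda,\\ & \|\boldsymbol{u}_i\|_2\le\gamma_i && \forall i\in\Lambda,\\ & \boldsymbol{\alpha}_i,\boldsymbol{\beta}_i\in\mathbb{R}^n_+,\ \boldsymbol{u}_i\in\mathbb{R}^n && \forall i\in\Lambda,\\ & v_i,\gamma_i\ge 0 && \forall i\in\Lambda, \end{aligned}$$ where $\sum_{j\le i}$ denotes summation over $j\in\{0,\dots,i\}$.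
   Context: Notation: $[n]=\{1,\dots,n\}$. For $\epsilon\in[0,1)$ and a real random variable $\mathrm{X}$, $\mathrm{CVaR}^{\epsilon}_{\mathrm{P}}[\mathrm{X}]=\inf_{t\in\mathbb{R}}\big(t+\frac{1}{1-\epsilon}\mathbb{E}_{\mathrm{P}}[[\mathrm{X}-t]_+]\big)$ with $[y]_+=\max\{0,y\}$. Joint possibility distribution. Given are $\hat{\boldsymbol{a}}=(\hat a_1,\dots,\hat a_n)\in\mathbb{R}^n$ (nominal scenario), deviations $\underline{a}_j,\overline{a}_j>0$ ($j\in[n]$) and a budget $\overline{\delta}>0$. For each $j\in[n]$, $\pi_{\tilde a_j}:\mathbb{R}\to[0,1]$ is continuous, equals $1$ at $\hat a_j$, is strictly increasing on $[\hat a_j-\underline{a}_j,\hat a_j]$, strictly decreasing on $[\hat a_j,\hat a_j+\overline{a}_j]$, and equals $0$ outside $[\hat a_j-\underline{a}_j,\hat a_j+\overline{a}_j]$. The function $\pi_{\tilde\delta}:[0,\infty)\to[0,1]$ is continuous, $\pi_{\tilde\delta}(0)=1$, strictly decreasing on $[0,\overline{\delta}]$, and $0$ on $[\overline{\delta},\infty)$. Set $$\pi(\boldsymbol{a})=\min\{\pi_{\tilde a_1}(a_1),\dots,\pi_{\tilde a_n}(a_n),\pi_{\tilde\delta}(\delta(\boldsymbol{a}))\}.$$ For $\lambda\in(0,1]$, $[\underline{a}_j(\lambda),\overline{a}_j(\lambda)]=\{y:\pi_{\tilde a_j}(y)\ge\lambda\}$ and $[0,\overline{\delta}(\lambda)]=\{y\ge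 0:\pi_{\tilde\delta}(y)\ge\lambda\}$; for $\lambda=0$, $\underline{a}_j(0)=\hat a_j-\underline{a}_j$, $\overline{a}_j(0)=\hat a_j+\overline{a}_j$, $\overline{\delta}(0)=\overline{\delta}$. (For example, for $\pi_{\tilde a_j}(y)=(1+\frac{y-\hat a_j}{\underline a_j})^{1/z_1}$ to the left and $(1+\frac{\hat a_j-y}{\overline a_j})^{1/z_2}$ to the right of $\hat a_j$ within its support, and $\pi_{\tilde\delta}(y)=(1-y/\overline\delta)^{1/z}$ on $[0,\overline\delta]$, with $z_1,z_2,z>0$, one has $\underline a_j(\lambda)=\hat a_j-\underline a_j(1-\lambda^{z_1})$, $\overline a_j(\lambda)=\hat a_j+\overline a_j(1-\lambda^{z_2})$, $\overline\delta(\lambda)=\overline\delta(1-\lambda^{z})$.) Write $\underline{\boldsymbol{a}}(\lambda)=(\underline{a}_j(\lambda))_{j\in[n]}$, $\overline{\boldsymbol{a}}(\lambda)=(\overline{a}_j(\lambda))_{j\in[n]}$. The confidence sets are $\mathcal{C}(\lambda)=\{\boldsymbol{a}:\pi(\boldsymbol{a})\ge\lambda\}=\{\boldsymbol{a}:\underline{\boldsymbol{a}}(\lambda)\le\boldsymbol{a}\le\overline{\boldsymbol{a}}(\lambda),\ \delta(\boldsymbol{a})\le\overline{\delta}(\lambda)\}$ for $\lambda\in(0,1]$ and $\mathcal{C}(0)=\{\boldsymbol{a}:\underline{\boldsymbol{a}}(0)\le\boldsymbol{a}\le\overline{\boldsymbol{a}}(0),\ \delta(\boldsymbol{a})\le\overline{\delta}\}=\mathcal{U}$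 (scenario set). Ambiguity set: $\mathcal{P}^{\ell}_\pi$ is the set of all Borel probability distributions $\mathrm{P}$ on $\mathcal{U}$ with $\mathrm{P}(\mathcal{C}(\lambda_i))\ge 1-\lambda_i$ for all $i\in\Lambda$; $\tilde{\boldsymbol{a}}$ is the random vector with distribution $\mathrm{P}$. *)

theory Defs
  imports "HOL-Probability.Probability"
begin

definition sym_pos_def :: "real^'n^'n \<Rightarrow> bool" where
  "sym_pos_def A \<longleftrightarrow> transpose A = A \<and> (\<forall>x. x \<noteq> 0 \<longrightarrow> x \<bullet> (A *v x) > 0)"

text \<open>\<open>inv_sqrt_of B S\<close> says that \<open>B = S^(-1/2)\<close>, the unique symmetric positive definite
  square root of the inverse of the symmetric positive definite matrix \<open>S\<close>.\<close>

definition inv_sqrt_of :: "real^'n^'n \<Rightarrow> real^'n^'n \<Rightarrow> bool" where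
  "inv_sqrt_of B S \<longleftrightarrow> sym_pos_def B \<and> B ** B = matrix_inv S"

definition cvar :: "real \<Rightarrow> 'a measure \<Rightarrow> ('a \<Rightarrow> real) \<Rightarrow> real" where
  "cvar \<epsilon> P X = (INF t. t + 1 / (1 - \<epsilon>) * (\<integral>a. max 0 (X a - t) \<partial>P))"

text \<open>A possibility distribution with peak \<open>c\<close> and support \<open>[c - l, c + u]\<close>.\<close>

definition marginal_possibility :: "real \<Rightarrow> real \<Rightarrow> real \<Rightarrow> (real \<Rightarrow> real) \<Rightarrow> bool" where
  "marginal_possibility c l u p \<longleftrightarrow>
     continuous_on UNIV p \<and> (\<forall>y. 0 \<le> p y \<and> p y \<le> 1) \<and> p c = 1 \<and>
     strict_mono_on {c - l..c} p \<and> monotone_on {c..c + u} (<) (>) p \<and>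
     (\<forall>y. y \<notin> {c - l..c + u} \<longrightarrow> p y = 0)"

text \<open>Only the values on \<open>[0, \<infinity>)\<close> matter.\<close>

definition deviation_possibility :: "real \<Rightarrow> (real \<Rightarrow> real) \<Rightarrow> bool" where
  "deviation_possibility D p \<longleftrightarrow>
     continuous_on {0..} p \<and> (\<forall>y\<ge>0. 0 \<le> p y \<and> p y \<le> 1) \<and> p 0 = 1 \<and>
     monotone_on {0..D} (<) (>) p \<and> (\<forall>y\<ge>D. p y = 0)"

definition joint_possibility ::
  "('n::finite \<Rightarrow> real \<Rightarrow> real) \<Rightarrow> (real \<Rightarrow> real) \<Rightarrow> (real^'n \<Rightarrow> real) \<Rightarrow> real^'n \<Rightarrow> real" where
  "joint_possibility pa pd \<delta> a = Min (insert (pd (\<delta> a)) (range (\<lambda>j. pa j (a $ j))))"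

text \<open>End points of the cuts at level \<open>r\<close>. For \<open>0 < r \<le> 1\<close> the superlevel sets are the intervals
  with these end points (\<open>marginal_cut_eq\<close> and \<open>deviation_cut_eq\<close> below).\<close>

definition lower_cut :: "real \<Rightarrow> real \<Rightarrow> (real \<Rightarrow> real) \<Rightarrow> real \<Rightarrow> real" where
  "lower_cut c l p r = (if r = 0 then c - l else Inf {y. p y \<ge> r})"

definition upper_cut :: "real \<Rightarrow> real \<Rightarrow> (real \<Rightarrow> real) \<Rightarrow> real \<Rightarrow> real" where
  "upper_cut c u p r = (if r = 0 then c + u else Sup {y. p y \<ge> r})"

definition deviation_cut :: "real \<Rightarrow> (real \<Rightarrow> real) \<Rightarrow> real \<Rightarrow> real" where
  "deviation_cut D p r = (if r = 0 then D else Sup {y. 0 \<le> y \<and> p y \<ge> r})"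

definition lower_vec :: "real^'n \<Rightarrow> real^'n \<Rightarrow> ('n \<Rightarrow> real \<Rightarrow> real) \<Rightarrow> real \<Rightarrow> real^'n" where
  "lower_vec ahat al pa r = (\<chi> j. lower_cut (ahat $ j) (al $ j) (pa j) r)"

definition upper_vec :: "real^'n \<Rightarrow> real^'n \<Rightarrow> ('n \<Rightarrow> real \<Rightarrow> real) \<Rightarrow> real \<Rightarrow> real^'n" where
  "upper_vec ahat au pa r = (\<chi> j. upper_cut (ahat $ j) (au $ j) (pa j) r)"

definition scenario_set ::
  "real^'n \<Rightarrow> real^'n \<Rightarrow> real^'n \<Rightarrow> real \<Rightarrow> (real^'n \<Rightarrow> real) \<Rightarrow> (real^'n) set" where
  "scenario_set ahat al au D \<delta> =
     {a. (\<forall>j. ahat $ j - al $ j \<le> a $ j \<and> a $ j \<le> ahat $ j + au $ j) \<and> \<delta> a \<le> D}"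

definition confidence_set ::
  "real^'n \<Rightarrow> real^'n \<Rightarrow> real^'n \<Rightarrow> real \<Rightarrow> ('n \<Rightarrow> real \<Rightarrow> real) \<Rightarrow> (real \<Rightarrow> real) \<Rightarrow>
   (real^'n \<Rightarrow> real) \<Rightarrow> real \<Rightarrow> (real^'n) set" where
  "confidence_set ahat al au D pa pd \<delta> r =
     (if r = 0 then scenario_set ahat al au D \<delta> else {a. joint_possibility pa pd \<delta> a \<ge> r})"

definition ambiguity_set ::
  "real^'n \<Rightarrow> real^'n \<Rightarrow> real^'n \<Rightarrow> real \<Rightarrow> ('n \<Rightarrow> real \<Rightarrow> real) \<Rightarrow> (real \<Rightarrow> real) \<Rightarrow>
   (real^'n \<Rightarrow> real) \<Rightarrow> nat \<Rightarrow> (real^'n) measure set" where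
  "ambiguity_set ahat al au D pa pd \<delta> l =
     {P. prob_space P \<and> sets P = sets (restrict_space borel (scenario_set ahat al au D \<delta>)) \<and>
         (\<forall>i\<in>{0..l}. measure P (confidence_set ahat al au D pa pd \<delta> (real i / real l))
            \<ge> 1 - real i / real l)}"

lemma marginal_cut_eq:
  assumes m: "marginal_possibility c l u p" and lu: "0 < l" "0 < u" and lam: "0 < r" "r \<le> 1"
  shows "{y. p y \<ge> r} = {lower_cut c l p r..upper_cut c u p r}"
proof -
  let ?S = "{y. p y \<ge> r}"
  have cont: "continuous_on UNIV p" and pc: "p c = 1"
    and inc: "strict_mono_on {c - l..c} p" and dec: "monotone_on {c..c + u} (<) (>) p"
    and out: "\<And>y. y \<notin> {c - l..c + u} \<Longrightarrow> p y = 0"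
    using m by (auto simp: marginal_possibility_def)
  have cS: "c \<in> ?S" using pc lam by simp
  have sub: "?S \<subseteq> {c - l..c + u}" using out lam by force
  have "closed ?S" by (intro closed_Collect_le continuous_on_const cont)
  with sub have comp: "compact ?S"
    by (meson bounded_closed_interval bounded_subset compact_eq_bounded_closed)
  have inc': "p x \<le> p y" if "c - l \<le> x" "x \<le> y" "y \<le> c" for x y
    using strict_mono_onD[OF inc, of x y] that by (cases "x = y") auto
  have dec': "p y \<le> p x" if "c \<le> x" "x \<le> y" "y \<le> c + u" for x y
    using monotone_onD[OF dec, of x y] that by (cases "x = y") auto
  have "is_interval ?S"
    unfolding is_interval_1
  proof (intro ballI allI impI)
    fix a b x assume ab: "a \<in> ?S" "b \<in> ?S" and x: "a \<le> x \<and> x \<le> b"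
    have r: "c - l \<le> a" "b \<le> c + u" using ab sub by (auto simp: subset_iff)
    show "x \<in> ?S"
    proof (cases "x \<le> c")
      case True
      with inc'[of a x] r x ab show ?thesis by auto
    next
      case False
      with dec'[of x b] r x ab show ?thesis by auto
    qed
  qed
  then have "connected ?S" by (simp add: is_interval_connected_1)
  with comp obtain a b where S: "?S = {a..b}"
    using connected_compact_interval_1 by blast
  with cS have "a \<le> b" by (metis atLeastatMost_empty_iff empty_iff)
  then show ?thesis using S lam by (simp add: lower_cut_def upper_cut_def)
qed

lemma deviation_cut_eq:
  assumes m: "deviation_possibility D p" and D: "0 < D" and lam: "0 < r" "r \<le> 1"
  shows "{y. 0 \<le> y \<and> p y \<ge> r} = {0..deviation_cut D p r}"
proof -
  let ?S = "{y. 0 \<le> y \<and> p y \<ge> r}"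
  have cont: "continuous_on {0..} p" and p0: "p 0 = 1"
    and dec: "monotone_on {0..D} (<) (>) p" and out: "\<And>y. y \<ge> D \<Longrightarrow> p y = 0"
    using m by (auto simp: deviation_possibility_def)
  have S0: "0 \<in> ?S" using p0 lam by simp
  have sub: "?S \<subseteq> {0..D}"
  proof
    fix y assume "y \<in> ?S"
    then show "y \<in> {0..D}" using out[of y] lam by (cases "y \<ge> D") auto
  qed
  have "closed {x \<in> {0..}. r \<le> p x}"
    by (intro continuous_on_closed_Collect_le continuous_on_const cont closed_atLeast)
  then have "closed ?S" by simp
  with sub have comp: "compact ?S"
    by (meson bounded_closed_interval bounded_subset compact_eq_bounded_closed)
  have dec': "p y \<le> p x" if "0 \<le> x" "x \<le> y" "y \<le> D" for x y
    using monotone_onD[OF dec, of x y] that by (cases "x = y") auto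
  have "is_interval ?S"
    unfolding is_interval_1
  proof (intro ballI allI impI)
    fix a b x assume ab: "a \<in> ?S" "b \<in> ?S" and x: "a \<le> x \<and> x \<le> b"
    have "0 \<le> a" "b \<le> D" using ab sub by (auto simp: subset_iff)
    with dec'[of x b] x ab show "x \<in> ?S" by auto
  qed
  then have "connected ?S" by (simp add: is_interval_connected_1)
  with comp obtain a b where S: "?S = {a..b}"
    using connected_compact_interval_1 by blast
  have "0 \<in> {a..b}" using S S0 by blast
  then have ab: "a \<le> 0" "a \<le> b" by auto
  then have "a \<in> ?S" using S by simp
  with ab have "a = 0" by simp
  with S ab lam show ?thesis by (simp add: deviation_cut_def)
qed

lemma confidence_set_eq:
  assumes "\<And>j. marginal_possibility (ahat $ j) (al $ j) (au $ j) (pa j)"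
    and "\<And>j. 0 < al $ j" "\<And>j. 0 < au $ j"
    and "deviation_possibility D pd" "0 < D" and "\<And>a. 0 \<le> \<delta> a" and "0 \<le> r" "r \<le> 1"
  shows "confidence_set ahat al au D pa pd \<delta> r =
    {a. (\<forall>j. lower_vec ahat al pa r $ j \<le> a $ j \<and> a $ j \<le> upper_vec ahat au pa r $ j) \<and>
        \<delta> a \<le> deviation_cut D pd r}"
proof (cases "r = 0")
  case True
  then show ?thesis
    by (simp add: confidence_set_def scenario_set_def lower_vec_def upper_vec_def
        lower_cut_def upper_cut_def deviation_cut_def)
next
  case False
  with assms have l: "0 < r" by simp
  have "r \<le> pa j y \<longleftrightarrow>
      lower_cut (ahat $ j) (al $ j) (pa j) r \<le> y \<and> y \<le> upper_cut (ahat $ j) (au $ j) (pa j) r"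
    for j y
    using marginal_cut_eq[OF assms(1-3) l assms(8), of j] by (auto simp: set_eq_iff)
  moreover have "r \<le> pd (\<delta> a) \<longleftrightarrow> \<delta> a \<le> deviation_cut D pd r" for a
    using deviation_cut_eq[OF assms(4,5) l assms(8)] assms(6)[of a] by (auto simp: set_eq_iff)
  ultimately show ?thesis using False
    by (auto simp: confidence_set_def joint_possibility_def lower_vec_def upper_vec_def)
qed

end

theory Submission
  imports Defs
begin

text \<open>The confidence sets \<open>C i\<close> are nested compacta. If \<open>v \<ge> 0\<close> and \<open>w - (\<Sum>j\<le>i. v j)\<close> dominates
  \<open>max 0 (a \<bullet> x - t)\<close> on \<open>C i\<close>, then \<open>max 0 (a \<bullet> x - t) \<le> w - (\<Sum>j. v j * indicator (C j) a)\<close> on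
  the scenario set, and integrating bounds the CVaR of every admissible distribution. Conversely, the
  uniform distribution on maximisers of \<open>a \<bullet> x\<close> over \<open>C 0, \<dots>, C (l - 1)\<close> is admissible and
  stochastically dominates all others, so no minimax theorem is needed; an optimal \<open>t\<close> for it
  yields \<open>w\<close> and \<open>v\<close> by summation by parts. Finally, a linear bound on a box intersected with an
  ellipsoid is dualised by separation; at level \<open>1\<close>, where Slater's condition fails, the box is a
  point and the dual solution is explicit.\<close>

section \<open>Conic duality for a box intersected with an ellipsoid\<close>

text \<open>Each summand of \<open>x\<close> meets one constraint: nonnegativity pairs \<alpha> and
  \<beta> with the upper and lower faces of the box, and Cauchy-Schwarz pairs \<open>u\<close> with
  the ellipsoid.\<close>

lemma box_ellipsoid_weak_duality:
  fixes p q d x \<alpha> \<beta> u :: "real^'n" and B :: "real^'n^'n"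
  assumes box: "\<And>j. - q $ j \<le> d $ j" "\<And>j. d $ j \<le> p $ j" and ell: "norm (B *v d) \<le> D"
    and x: "\<And>j. \<alpha> $ j - \<beta> $ j + column j B \<bullet> u = x $ j" and u: "norm u \<le> \<gamma>"
    and nonneg: "\<And>j. 0 \<le> \<alpha> $ j" "\<And>j. 0 \<le> \<beta> $ j"
  shows "d \<bullet> x \<le> p \<bullet> \<alpha> + q \<bullet> \<beta> + D * \<gamma>"
proof -
  have "x = \<alpha> - \<beta> + u v* B"
    using x by (simp add: vec_eq_iff vector_matrix_mult_def inner_vec_def column_def mult.commute)
  then have "d \<bullet> x = d \<bullet> \<alpha> + (- d) \<bullet> \<beta> + u \<bullet> (B *v d)"
    by (simp add: inner_right_distrib inner_diff_right dot_lmul_matrix[symmetric] inner_commute)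
  also have "d \<bullet> \<alpha> \<le> p \<bullet> \<alpha>"
    unfolding inner_vec_def by (intro sum_mono) (simp add: mult_right_mono box nonneg)
  also have "(- d) \<bullet> \<beta> \<le> q \<bullet> \<beta>"
    unfolding inner_vec_def
  proof (intro sum_mono)
    fix j
    have "- d $ j \<le> q $ j" using box(1)[of j] by simp
    from mult_right_mono[OF this nonneg(2)] show "(- d) $ j \<bullet> \<beta> $ j \<le> q $ j \<bullet> \<beta> $ j" by simp
  qed
  also have "u \<bullet> (B *v d) \<le> norm (B *v d) * norm u"
    using norm_cauchy_schwarz[of u "B *v d"] by (simp add: mult.commute)
  \<comment> \<open>Multiplying the two bounds needs \<open>0 \<le> D\<close>, which holds since
    \<open>D\<close> bounds a norm.\<close>
  also have "\<dots> \<le> D * \<gamma>"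
    using ell u by (intro mult_mono) (auto intro: order_trans[OF norm_ge_zero])
  finally show ?thesis by simp
qed

text \<open>Separating the hypograph of \<open>d \<mapsto> d \<bullet> x - M\<close> over the box from the half-cylinder over the
  ellipsoid splits \<open>x\<close> into a functional for the box and one for the ellipsoid. The box being a
  neighbourhood of \<open>0\<close> excludes a vertical hyperplane.\<close>

lemma box_ellipsoid_strong_duality:
  fixes p q x :: "real^'n" and B :: "real^'n^'n"
  assumes p: "\<And>j. 0 < p $ j" and q: "\<And>j. 0 < q $ j" and D: "0 \<le> D" and B: "invertible B"
    and M: "\<And>d. (\<And>j. - q $ j \<le> d $ j) \<Longrightarrow> (\<And>j. d $ j \<le> p $ j) \<Longrightarrow> norm (B *v d) \<le> D \<Longrightarrow> d \<bullet> x \<le> M"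
  shows "\<exists>\<alpha> \<beta> u. (\<forall>j. \<alpha> $ j - \<beta> $ j + column j B \<bullet> u = x $ j) \<and>
    (\<forall>j. 0 \<le> \<alpha> $ j \<and> 0 \<le> \<beta> $ j) \<and> p \<bullet> \<alpha> + q \<bullet> \<beta> + D * norm u \<le> M"
proof -
  define E where "E = {d. norm (B *v d) \<le> D}"
  let ?S = "{z. fst z \<in> cbox (- q) p \<and> snd z < fst z \<bullet> x - M}" and ?T = "E \<times> {0::real..}"
  have box: "d \<in> cbox (- q) p \<longleftrightarrow> (\<forall>j. - q $ j \<le> d $ j \<and> d $ j \<le> p $ j)" for d
    by (simp add: mem_box_cart)
  have E0: "0 \<in> E" using D by (simp add: E_def)
  have 0: "0 \<in> cbox (- q) p" using p q by (simp add: box less_imp_le)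
  have "E = (\<lambda>d. B *v d) -` cball 0 D" by (auto simp: E_def dist_norm)
  then have "convex E"
    using convex_linear_vimage[OF matrix_vector_mul_linear[of B] convex_cball] by simp
  then have T: "convex ?T" by (intro convex_Times) auto
  have S: "convex ?S"
  proof -
    have "?S = (fst -` cbox (- q) p) \<inter> {z. (- x, 1) \<bullet> z < - M}"
      by (auto simp: inner_prod_def inner_commute)
    then show ?thesis
      by (simp only:) (intro convex_Int convex_linear_vimage linear_fst convex_box convex_halfspace_lt)
  qed
  have "(0, - M - 1) \<in> ?S" using 0 by simp
  then have S0: "?S \<noteq> {}" by blast
  have T0: "?T \<noteq> {}" using E0 by auto
  \<comment> \<open>A common point would give a \<open>d\<close> in box and ellipsoid with
    \<open>d \<bullet> x > M\<close>.\<close>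
  have disj: "?S \<inter> ?T = {}"
    using M by (fastforce simp: box E_def)
  obtain h c where h: "h \<noteq> 0" "\<And>z. z \<in> ?S \<Longrightarrow> h \<bullet> z \<le> c" "\<And>z. z \<in> ?T \<Longrightarrow> c \<le> h \<bullet> z"
    using separating_hyperplane_sets[OF S T S0 T0 disj] by blast
  obtain z \<rho> where hz: "h = (z, \<rho>)" by fastforce
  have sep: "z \<bullet> d + \<rho> * r \<le> z \<bullet> e + \<rho> * s"
    if "d \<in> cbox (- q) p" "r < d \<bullet> x - M" "e \<in> E" "0 \<le> s" for d r e s
    using h(2)[of "(d, r)"] h(3)[of "(e, s)"] that by (simp add: hz inner_prod_def)
  \<comment> \<open>Compare two points over the origin: \<open>(0, - M - 1)\<close> in
    \<open>?S\<close> and \<open>(0, s)\<close> in \<open>?T\<close>, where \<open>s\<close> lies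
    strictly higher.\<close>
  have "0 \<le> \<rho>"
  proof (rule ccontr)
    assume "\<not> 0 \<le> \<rho>"
    then have "\<rho> < 0" by simp
    define s where "s = max 0 (- M)"
    have "\<rho> * (- M - 1) \<le> \<rho> * s" using sep[OF 0 _ E0, of "- M - 1" s] by (simp add: s_def)
    with \<open>\<rho> < 0\<close> have "s \<le> - M - 1" by simp
    then show False by (simp add: s_def)
  qed
  moreover have "\<rho> \<noteq> 0"
  proof
    assume "\<rho> = 0"
    with h(1) hz have z: "z \<noteq> 0" by (auto simp: zero_prod_def)
    have "0 \<in> box (- q) p" using p q by (simp add: mem_box_cart)
    then obtain \<epsilon> where \<epsilon>: "0 < \<epsilon>" "ball 0 \<epsilon> \<subseteq> box (- q) p"
      using open_contains_ball[of "box (- q) p"] open_box by blast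
    \<comment> \<open>With \<open>\<rho> = 0\<close> the separation reads
      \<open>z \<bullet> d \<le> 0\<close> on the whole box, which fails for a small positive
      multiple of \<open>z\<close>.\<close>
    define d where "d = (\<epsilon> / 2 / norm z) *\<^sub>R z"
    have "d \<in> ball 0 \<epsilon>" using \<epsilon> z by (simp add: d_def)
    then have "d \<in> cbox (- q) p" using \<epsilon> box_subset_cbox by blast
    from sep[OF this _ E0, of "d \<bullet> x - M - 1" 0] \<open>\<rho> = 0\<close> have "z \<bullet> d \<le> 0" by simp
    moreover have "0 < z \<bullet> d" using z \<epsilon> by (simp add: d_def)
    ultimately show False by simp
  qed
  ultimately have \<rho>: "0 < \<rho>" by simp
  \<comment> \<open>Dividing the separation by \<rho> splits \<open>x\<close> into \<open>y\<close>,
    paired with the box, and \<open>x - y = - z / \<rho>\<close>, paired with the ellipsoid. In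
    \<open>key\<close> the points \<open>d\<close> and \<open>e\<close> vary independently; the
    slack \<epsilon> comes from the strict inequality in \<open>?S\<close>.\<close>
  define y where "y = x + (1 / \<rho>) *\<^sub>R z"
  have key: "d \<bullet> y + e \<bullet> (x - y) \<le> M" if "d \<in> cbox (- q) p" "e \<in> E" for d e
  proof (rule field_le_epsilon)
    fix \<epsilon> :: real assume "0 < \<epsilon>"
    then have "z \<bullet> d + \<rho> * (d \<bullet> x - M - \<epsilon>) \<le> z \<bullet> e"
      using sep[OF that(1) _ that(2), of "d \<bullet> x - M - \<epsilon>" 0] by simp
    then have "(z \<bullet> d + \<rho> * (d \<bullet> x - M - \<epsilon>)) / \<rho> \<le> (z \<bullet> e) / \<rho>"
      using \<rho> by (simp add: divide_right_mono)
    then show "d \<bullet> y + e \<bullet> (x - y) \<le> M + \<epsilon>"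
      using \<rho> by (simp add: y_def inner_right_distrib inner_commute add_divide_distrib)
  qed
  define \<alpha> :: "real^'n" where "\<alpha> = (\<chi> j. max 0 (y $ j))"
  define \<beta> :: "real^'n" where "\<beta> = (\<chi> j. max 0 (- y $ j))"
  \<comment> \<open>The vertex of the box that maximises \<open>d \<bullet> y\<close>.\<close>
  define d :: "real^'n" where "d = (\<chi> j. if 0 \<le> y $ j then p $ j else - q $ j)"
  obtain C where C: "B ** C = mat 1" "C ** B = mat 1" using B by (auto simp: invertible_def)
  define u where "u = (x - y) v* C"
  \<comment> \<open>The maximiser of \<open>e \<bullet> (x - y)\<close> over the ellipsoid:
    \<open>B *v e\<close> has length \<open>D\<close> in the direction of \<open>u\<close>. For
    \<open>u = 0\<close> division by zero yields \<open>e = 0\<close>, which still attains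
    \<open>D * norm u\<close>.\<close>
  define e where "e = C *v ((D / norm u) *\<^sub>R u)"
  have uB: "u v* B = x - y"
    unfolding u_def by (simp add: vector_matrix_mul_assoc C)
  have Be: "B *v e = (D / norm u) *\<^sub>R u" unfolding e_def by (simp add: matrix_vector_mul_assoc C)
  have "e \<in> E" using D by (simp add: E_def Be)
  moreover have "d \<in> cbox (- q) p"
    using 0 by (auto simp: box d_def intro: order_trans[of _ 0])
  ultimately have "d \<bullet> y + e \<bullet> (x - y) \<le> M" by (intro key)
  moreover have "d \<bullet> y = p \<bullet> \<alpha> + q \<bullet> \<beta>"
    unfolding inner_vec_def sum.distrib[symmetric]
    by (intro sum.cong) (auto simp: d_def \<alpha>_def \<beta>_def max_def)
  moreover have "e \<bullet> (x - y) = D * norm u"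
    using Be by (simp add: uB[symmetric] dot_lmul_matrix inner_commute[of e]
        power2_norm_eq_inner[symmetric] power2_eq_square)
  moreover have "\<alpha> $ j - \<beta> $ j + column j B \<bullet> u = x $ j" for j
  proof -
    have "column j B \<bullet> u = (u v* B) $ j"
      by (simp add: vector_matrix_mult_def inner_vec_def column_def mult.commute)
    then show ?thesis by (simp add: uB \<alpha>_def \<beta>_def max_def)
  qed
  ultimately show ?thesis
    by (intro exI[of _ \<alpha>] exI[of _ \<beta>] exI[of _ u]) (auto simp: \<alpha>_def \<beta>_def)
qed

lemma sym_pos_def_invertible: "sym_pos_def A \<Longrightarrow> invertible A"
  unfolding invertible_left_inverse matrix_left_invertible_ker sym_pos_def_def
  by (metis inner_zero_right less_irrefl)

section \<open>Summation by parts and the infimum in CVaR\<close>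

text \<open>\<open>v j\<close> is subtracted once for each \<open>i\<close> in
  \<open>{j..<l}\<close>, that is \<open>l - j\<close> times. This turns a mean over
  \<open>l\<close> equally weighted points into the objective of the dual system.\<close>

lemma sum_partial_sums:
  fixes v :: "nat \<Rightarrow> real"
  assumes "0 < l"
  shows "(\<Sum>i<l. w - (\<Sum>j\<in>{0..i}. v j)) / real l = w + (\<Sum>i\<in>{0..l}. (real i / real l - 1) * v i)"
proof -
  \<comment> \<open>With the denominator cleared and \<open>n\<close> free, induction applies; each
    step lowers every coefficient by 1.\<close>
  have "(\<Sum>i<n. w - (\<Sum>j\<in>{0..i}. v j)) = real n * w + (\<Sum>i\<in>{0..n}. (real i - real n) * v i)" for n
  proof (induction n)
    case (Suc n)
    have "(\<Sum>i\<in>{0..n}. (real i - real (Suc n)) * v i)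
        = (\<Sum>i\<in>{0..n}. (real i - real n) * v i) - (\<Sum>i\<in>{0..n}. v i)"
      by (simp add: sum_subtractf[symmetric] algebra_simps)
    with Suc show ?case by (simp add: algebra_simps)
  qed simp
  then have "(\<Sum>i<l. w - (\<Sum>j\<in>{0..i}. v j)) / real l
      = (real l * w + (\<Sum>i\<in>{0..l}. (real i - real l) * v i)) / real l" by simp
  also have "\<dots> = w + (\<Sum>i\<in>{0..l}. (real i - real l) * v i / real l)"
    using assms by (simp add: add_divide_distrib sum_divide_distrib)
  also have "(\<Sum>i\<in>{0..l}. (real i - real l) * v i / real l) = (\<Sum>i\<in>{0..l}. (real i / real l - 1) * v i)"
    using assms by (intro sum.cong) (auto simp: field_simps)
  finally show ?thesis .
qed

text \<open>A real \<open>INF\<close> must be shown bounded below before it can be placed below its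
  members. Here \<open>expectation X\<close> is a lower bound, because the factor
  \<open>1 / (1 - \<epsilon>)\<close> is at least 1.\<close>

lemma (in prob_space) cvar_le:
  assumes X: "integrable M X" and \<epsilon>: "0 \<le> \<epsilon>" "\<epsilon> < 1"
  shows "cvar \<epsilon> M X \<le> t + 1 / (1 - \<epsilon>) * expectation (\<lambda>a. max 0 (X a - t))"
proof -
  have "expectation X \<le> s + 1 / (1 - \<epsilon>) * expectation (\<lambda>a. max 0 (X a - s))" for s
  proof -
    have int: "integrable M (\<lambda>a. max 0 (X a - s))" using X by simp
    have "expectation X = s + expectation (\<lambda>a. X a - s)" using X by (simp add: prob_space)
    also have "\<dots> \<le> s + 1 * expectation (\<lambda>a. max 0 (X a - s))"
      unfolding mult_1 using X int by (intro add_left_mono integral_mono) auto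
    also have "\<dots> \<le> s + 1 / (1 - \<epsilon>) * expectation (\<lambda>a. max 0 (X a - s))"
      using \<epsilon> by (intro add_left_mono mult_right_mono) (auto simp: field_simps)
    finally show ?thesis .
  qed
  then show ?thesis unfolding cvar_def by (intro cINF_lower bdd_belowI2) auto
qed

text \<open>The dual system asks for one \<open>t\<close> that meets the bound without slack, so the
  infimum has to be a minimum. The objective is piecewise linear, nonincreasing to the left of all
  \<open>m i\<close> and increasing to their right, so a minimiser on a compact interval is a global
  one.\<close>

lemma cvar_uniform_attained:
  fixes m :: "nat \<Rightarrow> real"
  assumes \<epsilon>: "0 \<le> \<epsilon>" "\<epsilon> < 1" and l: "0 < l"
    and le: "(INF t. t + 1 / (1 - \<epsilon>) * ((\<Sum>i<l. max 0 (m i - t)) / real l)) \<le> b"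
  shows "\<exists>t. t + 1 / (1 - \<epsilon>) * ((\<Sum>i<l. max 0 (m i - t)) / real l) \<le> b"
proof -
  define f where "f t = t + 1 / (1 - \<epsilon>) * ((\<Sum>i<l. max 0 (m i - t)) / real l)" for t
  define K where "K = (\<Sum>i<l. \<bar>m i\<bar>)"
  have K: "\<bar>m i\<bar> \<le> K" if "i < l" for i
    unfolding K_def using that by (intro member_le_sum) auto
  have K0: "0 \<le> K" unfolding K_def by (simp add: sum_nonneg)
  have "continuous_on {- K..K} f" unfolding f_def using l by (intro continuous_intros) auto
  then obtain t where t: "\<And>s. s \<in> {- K..K} \<Longrightarrow> f t \<le> f s"
    using continuous_attains_inf[of "{- K..K}" f] K0
    by (metis atLeastAtMost_iff compact_Icc empty_iff neg_le_0_iff_le)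
  have low: "f (- K) \<le> f s" if s: "s \<le> - K" for s
  proof -
    have eq: "(\<Sum>i<l. max 0 (m i - r)) / real l = (\<Sum>i<l. m i) / real l - r" if "r \<le> - K" for r
    proof -
      have "max 0 (m i - r) = m i - r" if "i < l" for i using K[OF that] \<open>r \<le> - K\<close> by auto
      then have "(\<Sum>i<l. max 0 (m i - r)) = (\<Sum>i<l. m i) - real l * r"
        by (simp add: sum_subtractf)
      then show ?thesis using l by (simp add: diff_divide_distrib)
    qed
    \<comment> \<open>The slope to the left of \<open>- K\<close> is
      \<open>1 - 1 / (1 - \<epsilon>)\<close>, which is at most 0.\<close>
    have "1 * (- K - s) \<le> 1 / (1 - \<epsilon>) * (- K - s)"
      using s \<epsilon> by (intro mult_right_mono) (auto simp: field_simps)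
    then show ?thesis unfolding f_def eq[OF s] eq[OF order_refl] right_diff_distrib by linarith
  qed
  have high: "f K \<le> f s" if "K \<le> s" for s
  proof -
    have z: "(\<Sum>i<l. max 0 (m i - r)) = 0" if "K \<le> r" for r
    proof (intro sum.neutral ballI)
      fix i assume "i \<in> {..<l}"
      with K[of i] that show "max 0 (m i - r) = 0" by auto
    qed
    show ?thesis using that by (simp add: f_def z)
  qed
  have "f t \<le> f s" for s
  proof -
    consider "s \<in> {- K..K}" | "s \<le> - K" | "K \<le> s" by fastforce
    then show ?thesis
    proof cases
      case 2
      then show ?thesis using low t[of "- K"] K0 by fastforce
    next
      case 3
      then show ?thesis using high t[of K] K0 by fastforce
    qed (use t in auto)
  qed
  then have "f t \<le> (INF s. f s)" by (intro cINF_greatest) auto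
  with le show ?thesis unfolding f_def by (meson order_trans)
qed


section \<open>Worst-case CVaR over a chain of confidence sets\<close>

text \<open>Stated for a continuous \<open>f\<close> on nested compacta. What remains is a robust
  constraint over each \<open>C i\<close>, which conic duality later replaces by finitely many conic
  inequalities when \<open>f\<close> is linear.\<close>

lemma worst_case_cvar_nested:
  fixes C :: "nat \<Rightarrow> 'a::t2_space set" and f :: "'a \<Rightarrow> real"
  assumes \<epsilon>: "0 \<le> \<epsilon>" "\<epsilon> < 1" and l: "0 < l"
    and C: "\<And>i. i \<le> l \<Longrightarrow> compact (C i)" "\<And>i. i \<le> l \<Longrightarrow> C i \<noteq> {}"
    and nested: "\<And>i j. i \<le> j \<Longrightarrow> j \<le> l \<Longrightarrow> C j \<subseteq> C i"
    and f: "continuous_on (C 0) f"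
  defines "\<P> \<equiv> {P. prob_space P \<and> sets P = sets (restrict_space borel (C 0)) \<and>
    (\<forall>i\<in>{0..l}. measure P (C i) \<ge> 1 - real i / real l)}"
  shows "(SUP P\<in>\<P>. ereal (cvar \<epsilon> P f)) \<le> ereal b \<longleftrightarrow>
    (\<exists>w t v. w + (\<Sum>i\<in>{0..l}. (real i / real l - 1) * v i) \<le> (b - t) * (1 - \<epsilon>) \<and>
      (\<forall>i\<in>{0..l}. 0 \<le> v i \<and> 0 \<le> w - (\<Sum>j\<in>{0..i}. v j) \<and>
        (\<forall>a\<in>C i. f a \<le> w - (\<Sum>j\<in>{0..i}. v j) + t)))" (is "_ \<longleftrightarrow> ?dual")
proof
  have sub: "C i \<subseteq> C 0" if "i \<le> l" for i using nested[of 0 i] that by simp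
  have meas_C: "C i \<in> sets (restrict_space borel (C 0))" if "i \<le> l" for i
    using C(1)[OF that] C(1)[of 0] sub[OF that]
    by (intro sets_restrict_space_iff[THEN iffD2]) (auto intro: borel_compact)
  have space: "space P = C 0" if "P \<in> \<P>" for P
    using that sets_eq_imp_space_eq[of P "restrict_space borel (C 0)"]
    by (simp add: \<P>_def space_restrict_space)
  have f_meas: "f \<in> borel_measurable (restrict_space borel (C 0))"
    using f by (rule borel_measurable_continuous_on_restrict)
  obtain K where K: "\<And>a. a \<in> C 0 \<Longrightarrow> \<bar>f a\<bar> \<le> K"
    using compact_continuous_image[OF f C(1)[of 0], THEN compact_imp_bounded]
    unfolding bounded_iff by auto
  have integrable: "integrable P f" if P: "P \<in> \<P>" for P
  proof -
    interpret prob_space P using P by (simp add: \<P>_def)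
    have "sets P = sets (restrict_space borel (C 0))" using P by (simp add: \<P>_def)
    then have "f \<in> borel_measurable P"
      using f_meas measurable_cong_sets[OF _ refl] by blast
    then show ?thesis
      using K space[OF P] by (intro integrable_const_bound[of _ K]) auto
  qed
  {
    assume ?dual
    then obtain w t v where obj: "w + (\<Sum>i\<in>{0..l}. (real i / real l - 1) * v i) \<le> (b - t) * (1 - \<epsilon>)"
      and v: "\<And>i. i \<le> l \<Longrightarrow> 0 \<le> v i" and w: "\<And>i. i \<le> l \<Longrightarrow> 0 \<le> w - (\<Sum>j\<in>{0..i}. v j)"
      and fw: "\<And>i a. i \<le> l \<Longrightarrow> a \<in> C i \<Longrightarrow> f a \<le> w - (\<Sum>j\<in>{0..i}. v j) + t"
      by fastforce
    have "cvar \<epsilon> P f \<le> b" if P: "P \<in> \<P>" for P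
    proof -
      interpret prob_space P using P by (simp add: \<P>_def)
      have sets: "C i \<in> sets P" if "i \<le> l" for i using P meas_C[OF that] by (simp add: \<P>_def)
      let ?g = "\<lambda>a. w - (\<Sum>j\<in>{0..l}. v j * indicator (C j) a)"
      have int: "integrable P (\<lambda>a. v j * indicator (C j) a :: real)" if "j \<in> {0..l}" for j
        using sets[of j] that
        by (intro integrable_mult_right integrable_real_indicator) (auto simp: emeasure_eq_measure)
      have le: "max 0 (f a - t) \<le> ?g a" if "a \<in> C 0" for a
      proof -
        \<comment> \<open>\<open>C i\<close> is the innermost set of the chain containing
          \<open>a\<close>. By nesting the indicators are 1 exactly up to index \<open>i\<close>, so
          the sum collapses to a partial sum.\<close>
        define i where "i = (GREATEST i. i \<le> l \<and> a \<in> C i)"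
        have i: "i \<le> l \<and> a \<in> C i"
          unfolding i_def using that GreatestI_nat[of "\<lambda>i. i \<le> l \<and> a \<in> C i" 0 l] by simp
        have max: "j \<le> i" if "j \<le> l" "a \<in> C j" for j
          unfolding i_def using that Greatest_le_nat[of "\<lambda>i. i \<le> l \<and> a \<in> C i" j l] by simp
        have "(\<Sum>j\<in>{0..l}. v j * indicator (C j) a) = (\<Sum>j\<in>{0..i}. v j)"
        proof (rule sum.mono_neutral_cong_right)
          show "v j * indicator (C j) a = v j" if "j \<in> {0..i}" for j
            using nested[of j i] i that by auto
          show "\<forall>j\<in>{0..l} - {0..i}. v j * indicator (C j) a = 0"
            using max by (fastforce simp: indicator_def)
        qed (use i in auto)
        then show ?thesis using fw[of i a] w[of i] i by simp
      qed
      have "expectation (\<lambda>a. max 0 (f a - t)) \<le> expectation ?g"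
      proof (rule integral_mono)
        show "integrable P ?g"
          by (intro Bochner_Integration.integrable_diff Bochner_Integration.integrable_sum
              integrable_const int)
        show "max 0 (f a - t) \<le> ?g a" if "a \<in> space P" for a
          using le that space[OF P] by blast
      qed (use integrable[OF P] in auto)
      also have "expectation ?g = expectation (\<lambda>_. w) - expectation (\<lambda>a. \<Sum>j\<in>{0..l}. v j * indicator (C j) a)"
        by (intro Bochner_Integration.integral_diff Bochner_Integration.integrable_sum
            integrable_const int)
      also have "expectation (\<lambda>_. w) = w" by (simp add: prob_space)
      also have "expectation (\<lambda>a. \<Sum>j\<in>{0..l}. v j * indicator (C j) a)
          = (\<Sum>j\<in>{0..l}. expectation (\<lambda>a. v j * indicator (C j) a))"
        by (intro Bochner_Integration.integral_sum int)
      also have "\<dots> = (\<Sum>j\<in>{0..l}. v j * prob (C j))"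
        using sub by (intro sum.cong refl) (simp add: space[OF P] Int_absorb2)
      \<comment> \<open>The probability bounds enter here; \<open>v \<ge> 0\<close> gives them the
        right direction.\<close>
      also have "w - \<dots> \<le> w - (\<Sum>j\<in>{0..l}. v j * (1 - real j / real l))"
        using P v by (intro diff_left_mono sum_mono mult_left_mono) (auto simp: \<P>_def)
      also have "\<dots> = w + (\<Sum>i\<in>{0..l}. (real i / real l - 1) * v i)"
        by (simp add: sum_subtractf algebra_simps)
      finally have "expectation (\<lambda>a. max 0 (f a - t)) \<le> (b - t) * (1 - \<epsilon>)" using obj by simp
      then have "1 / (1 - \<epsilon>) * expectation (\<lambda>a. max 0 (f a - t)) \<le> b - t"
        using \<epsilon> by (simp add: field_simps)
      with cvar_le[OF integrable[OF P] \<epsilon>, of t] show ?thesis by simp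
    qed
    then show "(SUP P\<in>\<P>. ereal (cvar \<epsilon> P f)) \<le> ereal b" by (simp add: SUP_le_iff)
  }
  assume sup: "(SUP P\<in>\<P>. ereal (cvar \<epsilon> P f)) \<le> ereal b"
  have "\<exists>a\<in>C i. \<forall>a'\<in>C i. f a' \<le> f a" if "i \<le> l" for i
    using continuous_attains_sup[OF C(1)[OF that] C(2)[OF that] continuous_on_subset[OF f sub[OF that]]] .
  then obtain a where a: "\<And>i. i \<le> l \<Longrightarrow> a i \<in> C i"
    and a_max: "\<And>i a'. i \<le> l \<Longrightarrow> a' \<in> C i \<Longrightarrow> f a' \<le> f (a i)"
    by metis
  \<comment> \<open>\<open>C i\<close> must carry mass \<open>(l - i) / l\<close>, so
    \<open>l\<close> points of weight \<open>1 / l\<close> suffice, one for each level from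
    \<open>0\<close> to \<open>l - 1\<close>; level \<open>l\<close> demands mass 0.\<close>
  define Q where "Q = measure_pmf (pmf_of_set {..<l})"
  \<comment> \<open>The space of \<open>Q\<close> is all of the naturals, so indices from
    \<open>l\<close> on get the default \<open>a 0\<close>, which keeps the map inside
    \<open>C 0\<close>.\<close>
  define a0 where "a0 i = a (if i < l then i else 0)" for i
  have a0_in: "a0 i \<in> C 0" for i
    using a[of i] a[of 0] sub[of i] l by (auto simp: a0_def)
  have a0: "a0 \<in> measurable Q (restrict_space borel (C 0))"
    by (simp add: Q_def space_restrict_space a0_in)
  define P where "P = distr Q (restrict_space borel (C 0)) a0"
  have int_P: "(\<integral>x. g x \<partial>P) = (\<Sum>i<l. g (a i)) / real l"
    if "g \<in> borel_measurable (restrict_space borel (C 0))" for g :: "'a \<Rightarrow> real"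
    using l unfolding P_def integral_distr[OF a0 that] unfolding Q_def
    by (subst integral_pmf_of_set) (auto simp: a0_def)
  have "P \<in> \<P>"
  proof -
    have "prob_space P"
      unfolding P_def using a0 by (intro prob_space.prob_space_distr) (auto simp: Q_def prob_space_measure_pmf)
    moreover have "measure P (C i) \<ge> 1 - real i / real l" if "i \<le> l" for i
    proof -
      \<comment> \<open>By nesting, the \<open>l - i\<close> points with index at least
        \<open>i\<close> all lie in \<open>C i\<close>.\<close>
      have "a k \<in> C i" if "i \<le> k" "k < l" for k
        using a[of k] nested[of i k] that by auto
      then have "{i..<l} \<subseteq> {..<l} \<inter> a0 -` C i" by (auto simp: a0_def)
      then have "card {i..<l} \<le> card ({..<l} \<inter> a0 -` C i)" by (intro card_mono) auto
      moreover have "measure P (C i) = real (card ({..<l} \<inter> a0 -` C i)) / real l"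
        using l unfolding P_def measure_distr[OF a0 meas_C[OF that]] unfolding Q_def
        by (subst measure_pmf_of_set) auto
      ultimately show ?thesis using l that by (simp add: field_simps of_nat_diff)
    qed
    ultimately show ?thesis by (simp add: \<P>_def P_def)
  qed
  with sup have "cvar \<epsilon> P f \<le> b" by (simp add: SUP_le_iff)
  moreover have "(\<integral>x. max 0 (f x - t) \<partial>P) = (\<Sum>i<l. max 0 (f (a i) - t)) / real l" for t
    by (intro int_P borel_measurable_max borel_measurable_diff borel_measurable_const f_meas)
  ultimately obtain t where t: "t + 1 / (1 - \<epsilon>) * ((\<Sum>i<l. max 0 (f (a i) - t)) / real l) \<le> b"
    using cvar_uniform_attained[OF \<epsilon> l, of "\<lambda>i. f (a i)" b] by (auto simp: cvar_def)
  define g where "g i = max 0 (f (a i) - t)" for i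
  \<comment> \<open>The differences telescope: with \<open>w = g 0\<close> and
    \<open>v 0 = 0\<close>, the value of \<open>w\<close> minus the partial sum up to
    \<open>i\<close> is \<open>g i\<close>. They are nonnegative because maxima over shrinking sets
    decrease.\<close>
  define v where "v i = (if i = 0 then 0 else g (i - 1) - g i)" for i
  have g: "g 0 - (\<Sum>j\<in>{0..i}. v j) = g i" for i
    by (induction i) (auto simp: v_def)
  have "0 \<le> v i" if "i \<le> l" for i
  proof (cases i)
    case (Suc j)
    then have "f (a i) \<le> f (a j)" using a_max[of j "a i"] a[of i] nested[of j i] that by auto
    with Suc show ?thesis by (simp add: v_def g_def)
  qed (simp add: v_def)
  moreover have "f x \<le> g i + t" if "i \<le> l" "x \<in> C i" for i x
    using a_max[OF that] by (simp add: g_def)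
  moreover have "0 \<le> g i" for i by (simp add: g_def)
  moreover have "(\<Sum>i<l. g i) / real l \<le> (b - t) * (1 - \<epsilon>)"
  proof -
    have "1 / (1 - \<epsilon>) * ((\<Sum>i<l. g i) / real l) \<le> b - t" using t by (simp add: g_def)
    then have "(1 - \<epsilon>) * (1 / (1 - \<epsilon>) * ((\<Sum>i<l. g i) / real l)) \<le> (1 - \<epsilon>) * (b - t)"
      using \<epsilon> by (intro mult_left_mono) auto
    then show ?thesis using \<epsilon> by (simp add: mult.commute[of "b - t"])
  qed
  then have "g 0 + (\<Sum>i\<in>{0..l}. (real i / real l - 1) * v i) \<le> (b - t) * (1 - \<epsilon>)"
    using sum_partial_sums[OF l, of "g 0" v] by (simp add: g)
  ultimately show ?dual
    by (intro exI[of _ "g 0"] exI[of _ t] exI[of _ v]) (auto simp: g)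
qed

section \<open>Cuts near the peak and linear bounds on a confidence set\<close>

text \<open>For positive \<open>r\<close>, continuity keeps \<open>p\<close> above \<open>r\<close>
  near the peak. Hence below level 1 the box shifted by the peak is a neighbourhood of the origin,
  as strong duality requires.\<close>

lemma cuts_around_peak:
  assumes m: "marginal_possibility c l u p" and lu: "0 < l" "0 < u" and r: "0 \<le> r" "r < 1"
  shows "lower_cut c l p r < c" and "c < upper_cut c u p r"
proof -
  have "lower_cut c l p r < c \<and> c < upper_cut c u p r"
  proof (cases "r = 0")
    case True
    then show ?thesis using lu by (simp add: lower_cut_def upper_cut_def)
  next
    case False
    have "continuous_on UNIV p" "p c = 1" using m by (auto simp: marginal_possibility_def)
    then have "open {y. r < p y}" "c \<in> {y. r < p y}"
      using r by (auto intro: open_Collect_less continuous_on_const)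
    then obtain e where e: "0 < e" "cball c e \<subseteq> {y. r < p y}"
      using open_contains_cball by blast
    have "y \<in> {y. r \<le> p y}" if "y \<in> {c - e, c + e}" for y
      using e that by (auto simp: subset_iff dist_norm less_imp_le)
    then have "c - e \<in> {y. r \<le> p y}" "c + e \<in> {y. r \<le> p y}" by blast+
    then show ?thesis using marginal_cut_eq[OF m lu, of r] r False e by auto
  qed
  then show "lower_cut c l p r < c" "c < upper_cut c u p r" by auto
qed

text \<open>Strict monotonicity on both sides leaves the peak as the only point of possibility
  1.\<close>

lemma cuts_at_one:
  assumes m: "marginal_possibility c l u p" and lu: "0 < l" "0 < u"
  shows "lower_cut c l p 1 = c" and "upper_cut c u p 1 = c"
proof -
  have p: "p c = 1" "strict_mono_on {c - l..c} p" "monotone_on {c..c + u} (<) (>) p"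
      "\<And>y. y \<notin> {c - l..c + u} \<Longrightarrow> p y = 0"
    using m by (auto simp: marginal_possibility_def)
  have "p y < 1" if "y \<noteq> c" for y
  proof (cases "y \<in> {c - l..c + u}")
    case True
    then show ?thesis
      using strict_mono_onD[OF p(2), of y c] monotone_onD[OF p(3), of c y] that lu p(1)
      by (cases "y < c") auto
  qed (use p(4) in simp)
  then have "{y. p y \<ge> 1} = {c}" using p(1) by force
  then have "{lower_cut c l p 1..upper_cut c u p 1} = {c}"
    using marginal_cut_eq[OF m lu, of 1] by simp
  then show "lower_cut c l p 1 = c" "upper_cut c u p 1 = c"
    by (metis atLeastAtMost_singleton_iff)+
qed

text \<open>Shifting by \<open>ahat\<close> moves the peak to the origin, where weak duality gives
  one direction and strong duality the other; the shift accounts for the constant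
  \<open>ahat \<bullet> x\<close>.\<close>

lemma confidence_set_linear_bound:
  fixes B :: "real^'n^'n" and ahat al au x :: "real^'n"
  assumes B: "invertible B" and pos: "\<And>j. 0 < al $ j" "\<And>j. 0 < au $ j" "0 < D"
    and pa: "\<And>j. marginal_possibility (ahat $ j) (al $ j) (au $ j) (pa j)"
    and pd: "deviation_possibility D pd" and r: "0 \<le> r" "r \<le> 1"
  shows "(\<forall>a\<in>confidence_set ahat al au D pa pd (\<lambda>a. norm (B *v (a - ahat))) r. a \<bullet> x \<le> c) \<longleftrightarrow>
    (\<exists>\<gamma> \<alpha> \<beta> u. (upper_vec ahat au pa r - ahat) \<bullet> \<alpha> + (ahat - lower_vec ahat al pa r) \<bullet> \<beta>
        + deviation_cut D pd r * \<gamma> + ahat \<bullet> x \<le> c \<and>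
      (\<forall>j. \<alpha> $ j - \<beta> $ j + column j B \<bullet> u = x $ j) \<and> norm u \<le> \<gamma> \<and>
      (\<forall>j. 0 \<le> \<alpha> $ j \<and> 0 \<le> \<beta> $ j) \<and> 0 \<le> \<gamma>)" (is "?bound \<longleftrightarrow> ?dual")
proof -
  define p where "p = upper_vec ahat au pa r - ahat"
  define q where "q = ahat - lower_vec ahat al pa r"
  define D' where "D' = deviation_cut D pd r"
  have "(a \<in> confidence_set ahat al au D pa pd (\<lambda>a. norm (B *v (a - ahat))) r) \<longleftrightarrow>
      (\<forall>j. - q $ j \<le> (a - ahat) $ j \<and> (a - ahat) $ j \<le> p $ j) \<and> norm (B *v (a - ahat)) \<le> D'" for a
    by (subst confidence_set_eq[OF pa pos(1,2) pd pos(3) norm_ge_zero r]) (simp add: p_def q_def D'_def)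
  note mem = this
  have D': "0 \<le> D'"
  proof (cases "r = 0")
    case False
    then have "(0::real) \<in> {y. 0 \<le> y \<and> r \<le> pd y}" using pd r by (simp add: deviation_possibility_def)
    then show ?thesis using deviation_cut_eq[OF pd pos(3), of r] r False by (simp add: D'_def)
  qed (use pos(3) in \<open>simp add: D'_def deviation_cut_def\<close>)
  show ?thesis
  proof
    assume ?dual
    then obtain \<gamma> \<alpha> \<beta> u where *: "p \<bullet> \<alpha> + q \<bullet> \<beta> + D' * \<gamma> + ahat \<bullet> x \<le> c"
      "\<And>j. \<alpha> $ j - \<beta> $ j + column j B \<bullet> u = x $ j" "norm u \<le> \<gamma>"
      "\<And>j. 0 \<le> \<alpha> $ j" "\<And>j. 0 \<le> \<beta> $ j"
      unfolding p_def q_def D'_def by blast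
    show ?bound
    proof
      fix a assume "a \<in> confidence_set ahat al au D pa pd (\<lambda>a. norm (B *v (a - ahat))) r"
      then have "(a - ahat) \<bullet> x \<le> p \<bullet> \<alpha> + q \<bullet> \<beta> + D' * \<gamma>"
        unfolding mem using * by (intro box_ellipsoid_weak_duality[where B = B and u = u]) auto
      with *(1) show "a \<bullet> x \<le> c" by (simp add: inner_diff_left)
    qed
  next
    assume bound: ?bound
    have "\<exists>\<alpha> \<beta> u. (\<forall>j. \<alpha> $ j - \<beta> $ j + column j B \<bullet> u = x $ j) \<and>
      (\<forall>j. 0 \<le> \<alpha> $ j \<and> 0 \<le> \<beta> $ j) \<and> p \<bullet> \<alpha> + q \<bullet> \<beta> + D' * norm u \<le> c - ahat \<bullet> x"
    proof (cases "r = 1")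
      case False
      have "0 < p $ j" "0 < q $ j" for j
        using cuts_around_peak[OF pa pos(1,2) r(1), of j] False r(2)
        by (auto simp: p_def q_def upper_vec_def lower_vec_def)
      moreover have "d \<bullet> x \<le> c - ahat \<bullet> x"
        if "\<And>j. - q $ j \<le> d $ j" "\<And>j. d $ j \<le> p $ j" "norm (B *v d) \<le> D'" for d
        using bound[rule_format, of "d + ahat"] that by (simp add: mem inner_add_left)
      ultimately show ?thesis using box_ellipsoid_strong_duality[OF _ _ D' B, of p q x] by blast
    next
      case True
      have "p = 0" "q = 0"
        using cuts_at_one[OF pa pos(1,2)]
        by (auto simp: True p_def q_def upper_vec_def lower_vec_def vec_eq_iff)
      moreover from this have "ahat \<bullet> x \<le> c"
        using bound[rule_format, of ahat] D' by (simp add: mem)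
      \<comment> \<open>The positive and negative parts of \<open>x\<close> with
        \<open>u = 0\<close> are dual feasible, at cost 0 since \<open>p\<close> and
        \<open>q\<close> vanish.\<close>
      ultimately show ?thesis
        by (intro exI[of _ "\<chi> j. max 0 (x $ j)"] exI[of _ "\<chi> j. max 0 (- x $ j)"] exI[of _ 0]) auto
    qed
    \<comment> \<open>The witness for \<gamma> is \<open>norm u\<close>.\<close>
    then show ?dual
      unfolding p_def q_def D'_def by (metis add.commute le_diff_eq norm_ge_zero order_refl)
  qed
qed

section \<open>Assembly of the second-order cone system\<close>

theorem corollary3:
  fixes X :: "(real^'n) set" and b \<epsilon> D :: real and l :: nat
    and S B :: "real^'n^'n" and ahat al au :: "real^'n"
    and pa :: "'n \<Rightarrow> real \<Rightarrow> real" and pd :: "real \<Rightarrow> real"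
    and \<delta> :: "real^'n \<Rightarrow> real" and lam :: "nat \<Rightarrow> real"
  assumes "0 \<le> \<epsilon>" "\<epsilon> < 1" and "0 < l"
    and lam: "\<And>i. lam i = real i / real l"
    and "sym_pos_def S" and "inv_sqrt_of B S"
    and "\<And>j. 0 < al $ j" and "\<And>j. 0 < au $ j" and "0 < D"
    and "\<And>j. marginal_possibility (ahat $ j) (al $ j) (au $ j) (pa j)"
    and "deviation_possibility D pd"
    and delta: "\<And>a. \<delta> a = norm (B *v (a - ahat))"
  shows "\<forall>x\<in>X.
    (SUP P\<in>ambiguity_set ahat al au D pa pd \<delta> l. ereal (cvar \<epsilon> P (\<lambda>a. a \<bullet> x))) \<le> ereal b \<longleftrightarrow>
    (\<exists>(w::real) (t::real) (v :: nat \<Rightarrow> real) (\<gamma> :: nat \<Rightarrow> real)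
       (\<alpha> :: nat \<Rightarrow> real^'n) (\<beta> :: nat \<Rightarrow> real^'n) (u :: nat \<Rightarrow> real^'n).
       w + (\<Sum>i\<in>{0..l}. (lam i - 1) * v i) \<le> (b - t) * (1 - \<epsilon>) \<and>
       (\<forall>i\<in>{0..l}.
          w - (\<Sum>j\<in>{0..i}. v j) \<ge> 0 \<and>
          w - (\<Sum>j\<in>{0..i}. v j) + t \<ge>
            (upper_vec ahat au pa (lam i) - ahat) \<bullet> \<alpha> i + (ahat - lower_vec ahat al pa (lam i)) \<bullet> \<beta> i
            + deviation_cut D pd (lam i) * \<gamma> i + ahat \<bullet> x \<and>
          (\<forall>j. \<alpha> i $ j - \<beta> i $ j + column j B \<bullet> u i = x $ j) \<and>
          norm (u i) \<le> \<gamma> i \<and>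
          (\<forall>j. 0 \<le> \<alpha> i $ j \<and> 0 \<le> \<beta> i $ j) \<and>
          0 \<le> v i \<and> 0 \<le> \<gamma> i))"
proof
  fix x assume "x \<in> X"
  define C where "C i = confidence_set ahat al au D pa pd \<delta> (lam i)" for i
  have inv: "invertible B"
    using \<open>inv_sqrt_of B S\<close> sym_pos_def_invertible by (auto simp: inv_sqrt_of_def)
  have lam01: "0 \<le> lam i" "lam i \<le> 1" if "i \<le> l" for i
    using that \<open>0 < l\<close> by (auto simp: lam)
  have \<delta>: "\<delta> = (\<lambda>a. norm (B *v (a - ahat)))" using delta by auto
  have C_eq: "C i = cbox (lower_vec ahat al pa (lam i)) (upper_vec ahat au pa (lam i)) \<inter>
      {a. \<delta> a \<le> deviation_cut D pd (lam i)}" if "i \<le> l" for i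
    unfolding C_def
    by (subst confidence_set_eq[OF assms(10,7,8,11,9) _ lam01[OF that]]) (auto simp: delta mem_box_cart)
  have compact: "compact (C i)" if "i \<le> l" for i
    unfolding C_eq[OF that] \<delta>
    by (intro compact_Int_closed compact_cbox closed_Collect_le continuous_intros
        bounded_linear.continuous_on[OF matrix_vector_mul_bounded_linear])
  have joint: "r \<le> joint_possibility pa pd \<delta> a \<longleftrightarrow> r \<le> pd (\<delta> a) \<and> (\<forall>j. r \<le> pa j (a $ j))" for r a
    by (auto simp: joint_possibility_def)
  have ahat: "ahat \<in> C i" if "i \<le> l" for i
  proof (cases "lam i = 0")
    case True
    then show ?thesis using assms(7-9)
      by (auto simp: C_def confidence_set_def scenario_set_def delta less_imp_le)
  next
    case False
    then show ?thesis using assms(10,11) lam01[OF that]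
      by (simp add: C_def confidence_set_def joint delta marginal_possibility_def deviation_possibility_def)
  qed
  have nested: "C j \<subseteq> C i" if "i \<le> j" "j \<le> l" for i j
  proof
    fix a assume a: "a \<in> C j"
    have ij: "lam i \<le> lam j" using that \<open>0 < l\<close> by (simp add: lam divide_right_mono)
    show "a \<in> C i"
    \<comment> \<open>Level 0 is treated apart: its set is the scenario set, whereas the superlevel
      set at 0 would be the whole space. A positive level \<open>lam j\<close> forces
      \<open>a\<close> into the supports.\<close>
    proof (cases "lam j = 0")
      case True
      with ij lam01(1)[of i] that have "lam i = lam j" by simp
      with a show ?thesis by (simp add: C_def)
    next
      case False
      with lam01(1)[OF that(2)] have j: "0 < lam j" by simp
      with a have le: "lam j \<le> pd (\<delta> a)" "\<And>k. lam j \<le> pa k (a $ k)"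
        by (auto simp: C_def confidence_set_def joint)
      show ?thesis
      proof (cases "lam i = 0")
        case True
        have "a $ k \<in> {ahat $ k - al $ k..ahat $ k + au $ k}" for k
          using assms(10)[of k] le(2)[of k] j by (force simp: marginal_possibility_def)
        moreover have "\<delta> a \<le> D"
          using assms(11) le(1) j unfolding deviation_possibility_def
          by (metis linorder_le_cases not_le)
        ultimately show ?thesis using True by (simp add: C_def confidence_set_def scenario_set_def)
      next
        case False
        then show ?thesis using le ij by (auto simp: C_def confidence_set_def joint intro: order_trans)
      qed
    qed
  qed
  \<comment> \<open>Since \<open>lam 0 = 0\<close>, the set \<open>C 0\<close> is the scenario
    set.\<close>
  have amb: "ambiguity_set ahat al au D pa pd \<delta> l =
      {P. prob_space P \<and> sets P = sets (restrict_space borel (C 0)) \<and>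
        (\<forall>i\<in>{0..l}. measure P (C i) \<ge> 1 - real i / real l)}"
    by (simp add: ambiguity_set_def C_def lam confidence_set_def)
  have bound: "(\<forall>a\<in>C i. a \<bullet> x \<le> c) \<longleftrightarrow>
      (\<exists>\<gamma> \<alpha> \<beta> u. (upper_vec ahat au pa (lam i) - ahat) \<bullet> \<alpha> + (ahat - lower_vec ahat al pa (lam i)) \<bullet> \<beta>
          + deviation_cut D pd (lam i) * \<gamma> + ahat \<bullet> x \<le> c \<and>
        (\<forall>j. \<alpha> $ j - \<beta> $ j + column j B \<bullet> u = x $ j) \<and> norm u \<le> \<gamma> \<and>
        (\<forall>j. 0 \<le> \<alpha> $ j \<and> 0 \<le> \<beta> $ j) \<and> 0 \<le> \<gamma>)" if "i \<in> {0..l}" for i c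
    unfolding C_def \<delta> using that lam01
    by (intro confidence_set_linear_bound[OF inv assms(7-11)]) auto
  have "continuous_on (C 0) (\<lambda>a. a \<bullet> x)" by (intro continuous_intros)
  note worst_case_cvar_nested[where C = C, OF assms(1-3) compact _ nested this, folded amb lam, of b]
  then have *: "(SUP P\<in>ambiguity_set ahat al au D pa pd \<delta> l. ereal (cvar \<epsilon> P (\<lambda>a. a \<bullet> x))) \<le> ereal b \<longleftrightarrow>
    (\<exists>w t v. w + (\<Sum>i\<in>{0..l}. (lam i - 1) * v i) \<le> (b - t) * (1 - \<epsilon>) \<and>
      (\<forall>i\<in>{0..l}. 0 \<le> v i \<and> 0 \<le> w - (\<Sum>j\<in>{0..i}. v j) \<and>
        (\<forall>a\<in>C i. a \<bullet> x \<le> w - (\<Sum>j\<in>{0..i}. v j) + t)))"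
    using ahat by blast
  have "(\<forall>i\<in>{0..l}. 0 \<le> v i \<and> 0 \<le> w - (\<Sum>j\<in>{0..i}. v j) \<and>
        (\<forall>a\<in>C i. a \<bullet> x \<le> w - (\<Sum>j\<in>{0..i}. v j) + t)) \<longleftrightarrow>
      (\<forall>i\<in>{0..l}. \<exists>\<gamma> \<alpha> \<beta> u. w - (\<Sum>j\<in>{0..i}. v j) \<ge> 0 \<and>
          w - (\<Sum>j\<in>{0..i}. v j) + t \<ge>
            (upper_vec ahat au pa (lam i) - ahat) \<bullet> \<alpha> + (ahat - lower_vec ahat al pa (lam i)) \<bullet> \<beta>
            + deviation_cut D pd (lam i) * \<gamma> + ahat \<bullet> x \<and>
          (\<forall>j. \<alpha> $ j - \<beta> $ j + column j B \<bullet> u = x $ j) \<and>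
          norm u \<le> \<gamma> \<and>
          (\<forall>j. 0 \<le> \<alpha> $ j \<and> 0 \<le> \<beta> $ j) \<and>
          0 \<le> v i \<and> 0 \<le> \<gamma>)" for w t v
    by (intro ball_cong refl) (simp only: bound, blast)
  \<comment> \<open>Bounded choice turns the dual witnesses of the single levels into functions of
    the index.\<close>
  note system = this[unfolded bchoice_iff]
  show "(SUP P\<in>ambiguity_set ahat al au D pa pd \<delta> l. ereal (cvar \<epsilon> P (\<lambda>a. a \<bullet> x))) \<le> ereal b \<longleftrightarrow>
    (\<exists>(w::real) (t::real) (v :: nat \<Rightarrow> real) (\<gamma> :: nat \<Rightarrow> real)
       (\<alpha> :: nat \<Rightarrow> real^'n) (\<beta> :: nat \<Rightarrow> real^'n) (u :: nat \<Rightarrow> real^'n).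
       w + (\<Sum>i\<in>{0..l}. (lam i - 1) * v i) \<le> (b - t) * (1 - \<epsilon>) \<and>
       (\<forall>i\<in>{0..l}.
          w - (\<Sum>j\<in>{0..i}. v j) \<ge> 0 \<and>
          w - (\<Sum>j\<in>{0..i}. v j) + t \<ge>
            (upper_vec ahat au pa (lam i) - ahat) \<bullet> \<alpha> i + (ahat - lower_vec ahat al pa (lam i)) \<bullet> \<beta> i
            + deviation_cut D pd (lam i) * \<gamma> i + ahat \<bullet> x \<and>
          (\<forall>j. \<alpha> i $ j - \<beta> i $ j + column j B \<bullet> u i = x $ j) \<and>
          norm (u i) \<le> \<gamma> i \<and>
          (\<forall>j. 0 \<le> \<alpha> i $ j \<and> 0 \<le> \<beta> i $ j) \<and>
          0 \<le> v i \<and> 0 \<le> \<gamma> i))"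
    unfolding * system by (simp only: ex_simps)
qed

end
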